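(* Let $\mathbf H_{ij}=\mathbf H(s_i,p_j)\in\mathbb C^{n_{out}\times n_{in}}$, $i=1,\dots,N$, $j=1,\dots,M$, be matrix-valued samples at distinct points $s_1,\dots,s_N\in\mathbb C$ and distinct points $p_1,\dots,p_M\in\mathbb C$. Let $\mathbf w\in\mathbb C^{n_{out}}$ and $\mathbf v\in\mathbb C^{n_{in}}$ be the unit vectors used by MIMO p-AAA (described in the context), let $\{s_i\}=\{\sigma_1,\dots,\sigma_k\}\cup\{\hat\sigma_1,\dots,\hat\sigma_{N-k}\}$ and $\{p_j\}=\{\pi_1,\dots,\pi_q\}\cup\{\hat\pi_1,\dots,\hat\pi_{M-q}\}$ be the resulting partition of the sampling points, and let $$\widetilde{\mathbf H}(s,p)=\frac{\mathbf N(s,p)}{d(s,p)}=\left.\sum_{i=1}^k\sum_{j=1}^q\frac{\alpha_{ij}\,\mathbf H(\sigma_i,\pi_j)}{(s-\sigma_i)(p-\pi_j)}\right/\sum_{i=1}^k\sum_{j=1}^q\frac{\alpha_{ij}}{(s-\sigma_i)(p-\pi_j)}$$ be the resulting approximant obtained via MIMO p-AAA, with $\alpha_{ij}\neq0$ for all $i,j$. Then $\widetilde{\mathbf H}$ interpolates the data at the selected samples, i.e. $$\widetilde{\mathbf H}(\sigma_i,\pi_j)=\mathbf H(\sigma_i,\pi_j),\qquad i=1,\dots,k,\ j=1,\dots,q$$ (where $\widetilde{\mathbf H}$ is evaluated at its removable singularity). Furthermore, $\widetilde{\mathbf H}=\mathbf N/d$ minimizes the input/output weighted linearized least-squares measure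 $$\sum_{(s,p)}\Bigl|\mathbf w^\top\bigl(\mathbf H(s,p)\,d(s,p)-\mathbf N(s,p)\bigr)\mathbf v\Bigr|^2,$$ where the sum runs over all sample pairs in $\{\hat\sigma_i\}\times\{\pi_j\}$, $\{\sigma_i\}\times\{\hat\pi_\ell\}$ and $\{\hat\sigma_i\}\times\{\hat\pi_\ell\}$, and the minimum is over all pairs $\mathbf N,d$ of the form $\mathbf N(s,p)=\sum_{i=1}^k\sum_{j=1}^q\frac{\alpha_{ij}\,\mathbf H(\sigma_i,\pi_j)}{(s-\sigma_i)(p-\pi_j)}$, $d(s,p)=\sum_{i=1}^k\sum_{j=1}^q\frac{\alpha_{ij}}{(s-\sigma_i)(p-\pi_j)}$ (same points $\sigma_i,\pi_j$) with coefficients $\alpha_{ij}\in\mathbb C$ satisfying $\sum_{i,j}|\alpha_{ij}|^2=1$. At pairs with $s=\sigma_i$ or $p=\pi_j$ the term $\mathbf H d-\mathbf N$ is understood as specified in the context.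
   Context: MIMO p-AAA. Pick two (random) unit vectors $\mathbf w\in\mathbb C^{n_{out}}$, $\mathbf v\in\mathbb C^{n_{in}}$, form the scalar data $h(s_i,p_j)=\mathbf w^\top\mathbf H(s_i,p_j)\mathbf v$, and apply the scalar algorithm p-AAA below to $h$. This yields a partition of the sampling points and coefficients $\alpha_{ij}$; the matrix-valued approximant is then $\widetilde{\mathbf H}$ in the displayed form of the claim, with these $\sigma_i,\pi_j,\alpha_{ij}$. Scalar p-AAA applied to data $h(s_i,p_j)$: start with $k=q=0$ and the constant approximant equal to the average of all data. While the stopping criterion (prescribed error tolerance or desired orders) is not met, choose a sample pair $(s_{\hat\imath},p_{\hat\jmath})$ maximizing $|h(s_i,p_j)-\widetilde H(s_i,p_j)|$ over all sample pairs, $\widetilde H$ being the current approximant; add $s_{\hat\imath}$ to the set $\{\sigma_i\}$ (increasing $k$ by one) if it is not already there, and $p_{\hat\jmath}$ to the set $\{\pi_j\}$ (increasing $q$ by one) if it is not already there; the remaining points are denoted $\hat\sigma_1,\dots,\hat\sigma_{N-k}$ and $\hat\pi_1,\dots,\hat\pi_{M-q}$. Then set $$[\alpha_{11}\cdots\alpha_{1q}\mid\cdots\mid\alpha_{k1}\cdots\alpha_{kq}]^\top\in\operatorname*{arg\,min}_{\|\mathbf a\|_2=1}\|\mathbb L_2\mathbf a\|_2,$$ $$\widetilde H(s,p)=\frac{n(s,p)}{d(s,p)}=\left.\sum_{i,j}\frac{h(\sigma_i,\pi_j)\alpha_{ij}}{(s-\sigma_i)(p-\pi_j)}\right/\sum_{i,j}\frac{\alpha_{ij}}{(s-\sigma_i)(p-\pi_j)}.$$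 Here $\mathbb L_2\in\mathbb C^{(MN-kq)\times kq}$ is the matrix, built from the scalar data $h$, whose action on $\mathbf a=(\alpha_{ij})$ (ordered as $\mathbf a=[\alpha_{11}\cdots\alpha_{1q}\mid\cdots\mid\alpha_{k1}\cdots\alpha_{kq}]^\top$) stacks the following numbers: - for each $i=1,\dots,k$, $\ell=1,\dots,M-q$: $\displaystyle\sum_{j=1}^q\frac{h(\sigma_i,\hat\pi_\ell)-h(\sigma_i,\pi_j)}{\hat\pi_\ell-\pi_j}\alpha_{ij}$; - for each $j=1,\dots,q$, $\hat\imath=1,\dots,N-k$: $\displaystyle\sum_{i=1}^k\frac{h(\hat\sigma_{\hat\imath},\pi_j)-h(\sigma_i,\pi_j)}{\hat\sigma_{\hat\imath}-\sigma_i}\alpha_{ij}$; - for each $\hat\imath=1,\dots,N-k$, $\hat\jmath=1,\dots,M-q$: $\displaystyle\sum_{i=1}^k\sum_{j=1}^q\frac{h(\hat\sigma_{\hat\imath},\hat\pi_{\hat\jmath})-h(\sigma_i,\pi_j)}{(\hat\sigma_{\hat\imath}-\sigma_i)(\hat\pi_{\hat\jmath}-\pi_j)}\alpha_{ij}$. Meaning of $\mathbf H d-\mathbf N$ at a sample pair: at $(\hat\sigma_{\hat\imath},\hat\pi_{\hat\jmath})$ it is the literal value. At $(\sigma_i,\hat\pi_\ell)$, where $\mathbf N$ and $d$ share the polar factor $1/(s-\sigma_i)$, that factor is cancelled: $d$ and $\mathbf N$ are replaced by $\sum_{j=1}^q\frac{\alpha_{ij}}{\hat\pi_\ell-\pi_j}$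 and $\sum_{j=1}^q\frac{\alpha_{ij}\mathbf H(\sigma_i,\pi_j)}{\hat\pi_\ell-\pi_j}$. At $(\hat\sigma_{\hat\imath},\pi_j)$, similarly, they are replaced by $\sum_{i=1}^k\frac{\alpha_{ij}}{\hat\sigma_{\hat\imath}-\sigma_i}$ and $\sum_{i=1}^k\frac{\alpha_{ij}\mathbf H(\sigma_i,\pi_j)}{\hat\sigma_{\hat\imath}-\sigma_i}$. *)

theory Defs
  imports "Jordan_Normal_Form.Matrix" "HOL-Analysis.Analysis"
begin

(* Matrix samples H(s,p) live in complex^'n_in^'n_out.  The Loewner matrix, whose size changes
   during the iteration, is a matrix of Jordan_Normal_Form (prefix Matrix below). *)

definition cscale :: "complex \<Rightarrow> complex^'n^'m \<Rightarrow> complex^'n^'m" where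
  "cscale c A = map_matrix ((*) c) A"

(* w^T A v, without complex conjugation of w. *)
definition weighted :: "complex^'m \<Rightarrow> complex^'n^'m \<Rightarrow> complex^'n \<Rightarrow> complex" where
  "weighted w A v = scalar_product w (A *v v)"

(* Value of f : D \<rightarrow> 'b at a point x that may be a removable singularity (x outside D). *)
definition takes_value :: "('a::topological_space \<Rightarrow> 'b::topological_space) \<Rightarrow> 'a set \<Rightarrow> 'a \<Rightarrow> 'b \<Rightarrow> bool"
  where "takes_value f D x y \<longleftrightarrow> x islimpt D \<and> (f \<longlongrightarrow> y) (at x within D)"


section \<open>Barycentric forms\<close>

(* The selected points are lists \<sigma>, \<pi> with k = length \<sigma> and q = length \<pi>; all indices,
   including those of the coefficients \<alpha> i j, start at 0. *)

definition bary_den :: "complex list \<Rightarrow> complex list \<Rightarrow> (nat \<Rightarrow> nat \<Rightarrow> complex) \<Rightarrow>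
    complex \<Rightarrow> complex \<Rightarrow> complex" where
  "bary_den \<sigma> \<pi> \<alpha> s p =
     (\<Sum>i<length \<sigma>. \<Sum>j<length \<pi>. \<alpha> i j / ((s - \<sigma> ! i) * (p - \<pi> ! j)))"

definition bary_num :: "complex list \<Rightarrow> complex list \<Rightarrow> (nat \<Rightarrow> nat \<Rightarrow> complex) \<Rightarrow>
    (complex \<Rightarrow> complex \<Rightarrow> complex) \<Rightarrow> complex \<Rightarrow> complex \<Rightarrow> complex" where
  "bary_num \<sigma> \<pi> \<alpha> h s p =
     (\<Sum>i<length \<sigma>. \<Sum>j<length \<pi>. h (\<sigma> ! i) (\<pi> ! j) * \<alpha> i j / ((s - \<sigma> ! i) * (p - \<pi> ! j)))"

definition bary_num_mat :: "complex list \<Rightarrow> complex list \<Rightarrow> (nat \<Rightarrow> nat \<Rightarrow> complex) \<Rightarrow>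
    (complex \<Rightarrow> complex \<Rightarrow> complex^'n^'m) \<Rightarrow> complex \<Rightarrow> complex \<Rightarrow> complex^'n^'m" where
  "bary_num_mat \<sigma> \<pi> \<alpha> H s p =
     (\<Sum>i<length \<sigma>. \<Sum>j<length \<pi>.
        cscale (\<alpha> i j / ((s - \<sigma> ! i) * (p - \<pi> ! j))) (H (\<sigma> ! i) (\<pi> ! j)))"

(* Where the quotients below are literally defined.  Outside this set HOL's x / 0 = 0 makes the
   formulas meaningless, and values have to be taken in the sense of takes_value. *)
definition bary_dom :: "complex list \<Rightarrow> complex list \<Rightarrow> (nat \<Rightarrow> nat \<Rightarrow> complex) \<Rightarrow> (complex \<times> complex) set"
  where "bary_dom \<sigma> \<pi> \<alpha> = {(s, p). s \<notin> set \<sigma> \<and> p \<notin> set \<pi> \<and> bary_den \<sigma> \<pi> \<alpha> s p \<noteq> 0}"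

definition mimo_approx :: "complex list \<Rightarrow> complex list \<Rightarrow> (nat \<Rightarrow> nat \<Rightarrow> complex) \<Rightarrow>
    (complex \<Rightarrow> complex \<Rightarrow> complex^'n^'m) \<Rightarrow> complex \<times> complex \<Rightarrow> complex^'n^'m" where
  "mimo_approx \<sigma> \<pi> \<alpha> H =
     (\<lambda>(s, p). cscale (1 / bary_den \<sigma> \<pi> \<alpha> s p) (bary_num_mat \<sigma> \<pi> \<alpha> H s p))"


section \<open>The matrix of the least-squares problem\<close>

definition remaining :: "complex list \<Rightarrow> complex list \<Rightarrow> complex list" where
  "remaining xs sel = filter (\<lambda>x. x \<notin> set sel) xs"

(* The coefficients in the order \<alpha>(0,0), ..., \<alpha>(0,q-1), \<alpha>(1,0), ...: the pair (i,j) is at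
   position c = i * q + j, so that i = c div q and j = c mod q. *)
definition stack :: "nat \<Rightarrow> nat \<Rightarrow> (nat \<Rightarrow> nat \<Rightarrow> complex) \<Rightarrow> complex Matrix.vec" where
  "stack k q \<alpha> = Matrix.vec (k * q) (\<lambda>c. \<alpha> (c div q) (c mod q))"

definition vec_norm2 :: "complex Matrix.vec \<Rightarrow> real" where
  "vec_norm2 a = L2_set (\<lambda>c. cmod (vec_index a c)) {..<dim_vec a}"

definition loewner2 :: "complex list \<Rightarrow> complex list \<Rightarrow> (complex \<Rightarrow> complex \<Rightarrow> complex) \<Rightarrow>
    complex list \<Rightarrow> complex list \<Rightarrow> complex Matrix.mat" where
  "loewner2 ss ps h \<sigma> \<pi> =
    (let k = length \<sigma>; q = length \<pi>; \<sigma>h = remaining ss \<sigma>; \<pi>h = remaining ps \<pi> in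
     mat_of_rows (k * q)
      ([Matrix.vec (k * q) (\<lambda>c. if c div q = i
          then (h (\<sigma> ! i) y - h (\<sigma> ! i) (\<pi> ! (c mod q))) / (y - \<pi> ! (c mod q)) else 0).
        i \<leftarrow> [0..<k], y \<leftarrow> \<pi>h] @
       [Matrix.vec (k * q) (\<lambda>c. if c mod q = j
          then (h x (\<pi> ! j) - h (\<sigma> ! (c div q)) (\<pi> ! j)) / (x - \<sigma> ! (c div q)) else 0).
        j \<leftarrow> [0..<q], x \<leftarrow> \<sigma>h] @
       [Matrix.vec (k * q) (\<lambda>c. (h x y - h (\<sigma> ! (c div q)) (\<pi> ! (c mod q)))
          / ((x - \<sigma> ! (c div q)) * (y - \<pi> ! (c mod q)))).
        x \<leftarrow> \<sigma>h, y \<leftarrow> \<pi>h]))"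


section \<open>The algorithm\<close>

(* (\<sigma>, \<pi>, \<alpha>); the coefficients are irrelevant as long as no point has been selected. *)
type_synonym paaa_state = "complex list \<times> complex list \<times> (nat \<Rightarrow> nat \<Rightarrow> complex)"

fun scalar_approx :: "complex list \<Rightarrow> complex list \<Rightarrow> (complex \<Rightarrow> complex \<Rightarrow> complex) \<Rightarrow>
    paaa_state \<Rightarrow> complex \<times> complex \<Rightarrow> complex" where
  "scalar_approx ss ps h (\<sigma>, \<pi>, \<alpha>) =
     (if \<sigma> = [] then (\<lambda>_. (\<Sum>s\<in>set ss. \<Sum>p\<in>set ps. h s p) / of_nat (length ss * length ps))
      else (\<lambda>(s, p). bary_num \<sigma> \<pi> \<alpha> h s p / bary_den \<sigma> \<pi> \<alpha> s p))"

fun scalar_dom :: "paaa_state \<Rightarrow> (complex \<times> complex) set" where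
  "scalar_dom (\<sigma>, \<pi>, \<alpha>) = (if \<sigma> = [] then UNIV else bary_dom \<sigma> \<pi> \<alpha>)"

(* V lists the values of the current approximant at the sample pairs.  Where the approximant has
   no value, not even as a removable singularity (a pole at a sample pair, which can occur if some
   coefficient vanishes), V is unconstrained: every way of treating such pairs is admitted. *)
definition sample_values :: "complex list \<Rightarrow> complex list \<Rightarrow> (complex \<Rightarrow> complex \<Rightarrow> complex) \<Rightarrow>
    paaa_state \<Rightarrow> (complex \<times> complex \<Rightarrow> complex) \<Rightarrow> bool" where
  "sample_values ss ps h st V \<longleftrightarrow>
     (\<forall>x \<in> set ss \<times> set ps. \<forall>y. takes_value (scalar_approx ss ps h st) (scalar_dom st) x y \<longrightarrow> V x = y)"

inductive paaa_step :: "complex list \<Rightarrow> complex list \<Rightarrow> (complex \<Rightarrow> complex \<Rightarrow> complex) \<Rightarrow>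
    paaa_state \<Rightarrow> paaa_state \<Rightarrow> bool" for ss ps h where
  "\<lbrakk> sample_values ss ps h (\<sigma>, \<pi>, \<alpha>) V;
     is_arg_max (\<lambda>(s, p). cmod (h s p - V (s, p))) (\<lambda>x. x \<in> set ss \<times> set ps) (s', p');
     \<sigma>' = (if s' \<in> set \<sigma> then \<sigma> else \<sigma> @ [s']);
     \<pi>' = (if p' \<in> set \<pi> then \<pi> else \<pi> @ [p']);
     is_arg_min (\<lambda>a. vec_norm2 (loewner2 ss ps h \<sigma>' \<pi>' *\<^sub>v a))
       (\<lambda>a. a \<in> carrier_vec (length \<sigma>' * length \<pi>') \<and> vec_norm2 a = 1)
       (stack (length \<sigma>') (length \<pi>') \<alpha>') \<rbrakk>
   \<Longrightarrow> paaa_step ss ps h (\<sigma>, \<pi>, \<alpha>) (\<sigma>', \<pi>', \<alpha>')"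

(* States visited by the loop; the stopping criterion is an arbitrary predicate on states, which
   covers error tolerances as well as prescribed orders (k, q). *)
inductive paaa_reach :: "(paaa_state \<Rightarrow> bool) \<Rightarrow> complex list \<Rightarrow> complex list \<Rightarrow>
    (complex \<Rightarrow> complex \<Rightarrow> complex) \<Rightarrow> paaa_state \<Rightarrow> bool" for stop ss ps h where
  start: "paaa_reach stop ss ps h ([], [], \<lambda>_ _. 0)"
| iterate: "\<lbrakk> paaa_reach stop ss ps h st; \<not> stop st; paaa_step ss ps h st st' \<rbrakk>
    \<Longrightarrow> paaa_reach stop ss ps h st'"

definition paaa_result :: "(paaa_state \<Rightarrow> bool) \<Rightarrow> complex list \<Rightarrow> complex list \<Rightarrow>
    (complex \<Rightarrow> complex \<Rightarrow> complex) \<Rightarrow> paaa_state \<Rightarrow> bool" where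
  "paaa_result stop ss ps h st \<longleftrightarrow> paaa_reach stop ss ps h st \<and> stop st"

definition mimo_paaa_result :: "(paaa_state \<Rightarrow> bool) \<Rightarrow> complex^'m \<Rightarrow> complex^'n \<Rightarrow>
    complex list \<Rightarrow> complex list \<Rightarrow> (complex \<Rightarrow> complex \<Rightarrow> complex^'n^'m) \<Rightarrow> paaa_state \<Rightarrow> bool" where
  "mimo_paaa_result stop w v ss ps H st \<longleftrightarrow> paaa_result stop ss ps (\<lambda>s p. weighted w (H s p) v) st"


section \<open>The weighted linearized least-squares measure\<close>

(* H d - N at the three kinds of sample pairs; in the first two the polar factor 1 / (s - \<sigma> ! i),
   respectively 1 / (p - \<pi> ! j), common to d and N is cancelled. *)

definition residual_row :: "complex list \<Rightarrow> complex list \<Rightarrow> (complex \<Rightarrow> complex \<Rightarrow> complex^'n^'m) \<Rightarrow>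
    (nat \<Rightarrow> nat \<Rightarrow> complex) \<Rightarrow> nat \<Rightarrow> complex \<Rightarrow> complex^'n^'m" where
  "residual_row \<sigma> \<pi> H \<alpha> i p =
     cscale (\<Sum>j<length \<pi>. \<alpha> i j / (p - \<pi> ! j)) (H (\<sigma> ! i) p)
     - (\<Sum>j<length \<pi>. cscale (\<alpha> i j / (p - \<pi> ! j)) (H (\<sigma> ! i) (\<pi> ! j)))"

definition residual_col :: "complex list \<Rightarrow> complex list \<Rightarrow> (complex \<Rightarrow> complex \<Rightarrow> complex^'n^'m) \<Rightarrow>
    (nat \<Rightarrow> nat \<Rightarrow> complex) \<Rightarrow> complex \<Rightarrow> nat \<Rightarrow> complex^'n^'m" where
  "residual_col \<sigma> \<pi> H \<alpha> s j =
     cscale (\<Sum>i<length \<sigma>. \<alpha> i j / (s - \<sigma> ! i)) (H s (\<pi> ! j))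
     - (\<Sum>i<length \<sigma>. cscale (\<alpha> i j / (s - \<sigma> ! i)) (H (\<sigma> ! i) (\<pi> ! j)))"

definition residual_off :: "complex list \<Rightarrow> complex list \<Rightarrow> (complex \<Rightarrow> complex \<Rightarrow> complex^'n^'m) \<Rightarrow>
    (nat \<Rightarrow> nat \<Rightarrow> complex) \<Rightarrow> complex \<Rightarrow> complex \<Rightarrow> complex^'n^'m" where
  "residual_off \<sigma> \<pi> H \<alpha> s p = cscale (bary_den \<sigma> \<pi> \<alpha> s p) (H s p) - bary_num_mat \<sigma> \<pi> \<alpha> H s p"

definition weighted_ls :: "complex^'m \<Rightarrow> complex^'n \<Rightarrow> complex list \<Rightarrow> complex list \<Rightarrow>
    (complex \<Rightarrow> complex \<Rightarrow> complex^'n^'m) \<Rightarrow> complex list \<Rightarrow> complex list \<Rightarrow>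
    (nat \<Rightarrow> nat \<Rightarrow> complex) \<Rightarrow> real" where
  "weighted_ls w v ss ps H \<sigma> \<pi> \<alpha> =
     (\<Sum>s\<in>set ss - set \<sigma>. \<Sum>j<length \<pi>. (cmod (weighted w (residual_col \<sigma> \<pi> H \<alpha> s j) v))\<^sup>2)
     + (\<Sum>i<length \<sigma>. \<Sum>p\<in>set ps - set \<pi>. (cmod (weighted w (residual_row \<sigma> \<pi> H \<alpha> i p) v))\<^sup>2)
     + (\<Sum>s\<in>set ss - set \<sigma>. \<Sum>p\<in>set ps - set \<pi>. (cmod (weighted w (residual_off \<sigma> \<pi> H \<alpha> s p) v))\<^sup>2)"

end

theory Submission
  imports Defs
begin

text \<open>Interpolation: multiplying numerator and denominator by \<open>(s - \<sigma>\<^sub>i) (p - \<pi>\<^sub>j)\<close> makes both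
  continuous at \<open>(\<sigma>\<^sub>i, \<pi>\<^sub>j)\<close>, with values \<open>\<alpha>\<^sub>i\<^sub>j H(\<sigma>\<^sub>i, \<pi>\<^sub>j)\<close> and \<open>\<alpha>\<^sub>i\<^sub>j \<noteq> 0\<close>. Optimality:
  \<open>A \<mapsto> w\<^sup>T A v\<close> is linear, so the weighted residuals of \<open>H d - N\<close> are the entries of \<open>\<L>\<^sub>2 a\<close> for
  the scalar data \<open>w\<^sup>T H v\<close>, and the measure is the squared norm minimized in the last step of the
  scalar algorithm.\<close>

section \<open>Interpolation\<close>

text \<open>\<open>(s - \<sigma>\<^sub>i) (p - \<pi>\<^sub>j) d(s, p)\<close> with the pole at \<open>(\<sigma>\<^sub>i, \<pi>\<^sub>j)\<close> cancelled. By the choice of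
  coefficients it also describes the entries of the numerator.\<close>

definition cleared_den :: "complex list \<Rightarrow> complex list \<Rightarrow> nat \<Rightarrow> nat \<Rightarrow> (nat \<Rightarrow> nat \<Rightarrow> complex) \<Rightarrow>
    complex \<times> complex \<Rightarrow> complex" where
  "cleared_den \<sigma> \<pi> i j c = (\<lambda>x. \<Sum>a<length \<sigma>. \<Sum>b<length \<pi>. c a b *
     ((if a = i then 1 else (fst x - \<sigma> ! i) / (fst x - \<sigma> ! a)) *
      (if b = j then 1 else (snd x - \<pi> ! j) / (snd x - \<pi> ! b))))"

text \<open>Termwise cancellation. Only the coordinates \<open>\<sigma> ! i\<close> and
  \<open>\<pi> ! j\<close> have to be avoided: at any other node \<open>x / 0 = 0\<close> makes the
  affected terms vanish on both sides.\<close>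

lemma cleared_den_eq:
  assumes "s \<noteq> \<sigma> ! i" "p \<noteq> \<pi> ! j"
  shows "cleared_den \<sigma> \<pi> i j c (s, p) = (s - \<sigma> ! i) * (p - \<pi> ! j) * bary_den \<sigma> \<pi> c s p"
  using assms unfolding cleared_den_def bary_den_def sum_distrib_left
  by (intro sum.cong) auto

text \<open>For \<open>a \<noteq> i\<close> the factor has numerator tending to 0 and, by
  distinctness, denominator tending to a nonzero number; likewise for \<open>b \<noteq> j\<close>.
  Only the term \<open>(i, j)\<close> survives.\<close>

lemma tendsto_cleared_den:
  assumes "distinct \<sigma>" "distinct \<pi>" "i < length \<sigma>" "j < length \<pi>"
  shows "(cleared_den \<sigma> \<pi> i j c \<longlongrightarrow> c i j) (nhds (\<sigma> ! i, \<pi> ! j))"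
proof -
  \<comment> \<open>Stated for an arbitrary list and coordinate function so that it serves both
    \<open>fst\<close> with \<open>\<sigma>\<close> and \<open>snd\<close> with
    \<open>\<pi>\<close>.\<close>
  have lim: "((\<lambda>x. if a = i then 1 else (g x - xs ! i) / (g x - xs ! a)) \<longlongrightarrow> (if a = i then 1 else 0)) F"
    if "distinct xs" "i < length xs" "a < length xs" "(g \<longlongrightarrow> xs ! i) F"
    for xs :: "complex list" and g :: "complex \<times> complex \<Rightarrow> complex" and a i F
  proof (cases "a = i")
    case False
    then have "xs ! i - xs ! a \<noteq> 0" using that by (simp add: nth_eq_iff_index_eq)
    from tendsto_divide[OF tendsto_diff[OF that(4) tendsto_const[of "xs ! i"]]
        tendsto_diff[OF that(4) tendsto_const[of "xs ! a"]] this]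
    show ?thesis using False by simp
  qed simp
  have id: "((\<lambda>x. x) \<longlongrightarrow> (\<sigma> ! i, \<pi> ! j)) (nhds (\<sigma> ! i, \<pi> ! j))"
    by (simp add: filterlim_def)
  have "(cleared_den \<sigma> \<pi> i j c \<longlongrightarrow> (\<Sum>a<length \<sigma>. \<Sum>b<length \<pi>. c a b *
      ((if a = i then 1 else 0) * (if b = j then 1 else 0)))) (nhds (\<sigma> ! i, \<pi> ! j))"
    unfolding cleared_den_def
    using assms tendsto_fst[OF id] tendsto_snd[OF id]
    by (intro tendsto_sum tendsto_mult tendsto_const lim) auto
  also have "(\<Sum>a<length \<sigma>. \<Sum>b<length \<pi>. c a b *
      ((if a = i then 1 else 0) * (if b = j then 1 else 0))) = c i j"
    using assms by (simp add: mult_delta_right)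
  finally show ?thesis .
qed

section \<open>The domain of the approximant near a selected pair\<close>

lemma eventually_notin_finite:
  fixes x :: "'a::t1_space"
  assumes "finite A"
  shows "eventually (\<lambda>y. y \<noteq> x \<longrightarrow> y \<notin> A) (nhds x)"
proof -
  have "eventually (\<lambda>y. y \<in> - (A - {x})) (nhds x)"
    using assms by (intro eventually_nhds_in_open open_Compl finite_imp_closed) auto
  then show ?thesis by eventually_elim auto
qed

text \<open>The cleared denominator tends to \<open>\<alpha> i j \<noteq> 0\<close>, so it has no
  zeros nearby; off the two polar lines this forces \<open>bary_den\<close> to be nonzero.\<close>

lemma eventually_bary_dom:
  assumes "distinct \<sigma>" "distinct \<pi>" "i < length \<sigma>" "j < length \<pi>" "\<alpha> i j \<noteq> 0"
  shows "eventually (\<lambda>(s, p). s \<noteq> \<sigma> ! i \<longrightarrow> p \<noteq> \<pi> ! j \<longrightarrow> (s, p) \<in> bary_dom \<sigma> \<pi> \<alpha>)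
    (nhds (\<sigma> ! i, \<pi> ! j))"
proof -
  have "eventually (\<lambda>x. cleared_den \<sigma> \<pi> i j \<alpha> x \<noteq> 0) (nhds (\<sigma> ! i, \<pi> ! j))"
    using tendsto_cleared_den[OF assms(1-4)] assms(5) by (rule tendsto_imp_eventually_ne)
  moreover have "eventually (\<lambda>x. (fst x \<noteq> \<sigma> ! i \<longrightarrow> fst x \<notin> set \<sigma>) \<and> (snd x \<noteq> \<pi> ! j \<longrightarrow> snd x \<notin> set \<pi>))
      (nhds (\<sigma> ! i, \<pi> ! j))"
    unfolding nhds_prod
    by (intro eventually_conj
        eventually_compose_filterlim[OF _ filterlim_fst] eventually_compose_filterlim[OF _ filterlim_snd]
        eventually_notin_finite) auto
  ultimately show ?thesis
    by eventually_elim (auto simp: bary_dom_def cleared_den_eq)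
qed

lemma islimpt_bary_dom:
  assumes "distinct \<sigma>" "distinct \<pi>" "i < length \<sigma>" "j < length \<pi>" "\<alpha> i j \<noteq> 0"
  shows "(\<sigma> ! i, \<pi> ! j) islimpt bary_dom \<sigma> \<pi> \<alpha>"
proof -
  \<comment> \<open>The diagonal path leaves both polar lines as soon as
    \<open>t \<noteq> 0\<close>, hence runs inside the domain for small \<open>t\<close>.\<close>
  let ?x = "(\<sigma> ! i, \<pi> ! j)" and ?f = "\<lambda>t. (\<sigma> ! i + t, \<pi> ! j + t)"
  have "(?f \<longlongrightarrow> (\<sigma> ! i + 0, \<pi> ! j + 0)) (at 0)"
    by (intro tendsto_intros)
  then have f: "(?f \<longlongrightarrow> ?x) (at 0)" by simp
  have "eventually (\<lambda>t. t \<noteq> 0) (at (0::complex))"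
    by (simp add: eventually_at_filter)
  with eventually_compose_filterlim[OF eventually_bary_dom[of \<sigma> \<pi> i j \<alpha>, OF assms] f]
  have "eventually (\<lambda>t. ?f t \<in> bary_dom \<sigma> \<pi> \<alpha> \<and> ?f t \<noteq> ?x) (at 0)"
    by eventually_elim auto
  with f have "filterlim ?f (at ?x within bary_dom \<sigma> \<pi> \<alpha>) (at 0)"
    by (auto simp: filterlim_at elim: eventually_mono)
  \<comment> \<open>A filter to which a map converges along the nontrivial filter
    \<open>at 0\<close> cannot be \<open>bot\<close>.\<close>
  then have "at ?x within bary_dom \<sigma> \<pi> \<alpha> \<noteq> bot"
    by (auto simp: filterlim_def filtermap_bot_iff bot_unique)
  then show ?thesis by (simp add: trivial_limit_within)
qed

text \<open>Each entry of the numerator is itself a \<open>bary_den\<close>, with coefficients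
  weighted by the data, so one limit lemma covers numerator and denominator.\<close>

lemma mimo_approx_nth:
  "vec_nth (vec_nth (mimo_approx \<sigma> \<pi> \<alpha> H (s, p)) r) c =
     bary_den \<sigma> \<pi> (\<lambda>i j. \<alpha> i j * vec_nth (vec_nth (H (\<sigma> ! i) (\<pi> ! j)) r) c) s p / bary_den \<sigma> \<pi> \<alpha> s p"
  by (simp add: mimo_approx_def bary_num_mat_def cscale_def map_matrix_def sum_component)
    (simp add: bary_den_def)

text \<open>Convergence is checked entry by entry. On the domain the polar factors are nonzero and
  cancel, so each entry equals a quotient of two cleared forms with limits \<open>?c i j\<close> and
  \<open>\<alpha> i j\<close>.\<close>

lemma mimo_approx_interpolates:
  assumes "distinct \<sigma>" "distinct \<pi>" "i < length \<sigma>" "j < length \<pi>" "\<alpha> i j \<noteq> 0"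
  shows "takes_value (mimo_approx \<sigma> \<pi> \<alpha> H) (bary_dom \<sigma> \<pi> \<alpha>) (\<sigma> ! i, \<pi> ! j) (H (\<sigma> ! i) (\<pi> ! j))"
  unfolding takes_value_def
proof (intro conjI islimpt_bary_dom assms vec_tendstoI)
  fix r c
  let ?F = "at (\<sigma> ! i, \<pi> ! j) within bary_dom \<sigma> \<pi> \<alpha>"
  let ?c = "\<lambda>i j. \<alpha> i j * vec_nth (vec_nth (H (\<sigma> ! i) (\<pi> ! j)) r) c"
  have le: "?F \<le> nhds (\<sigma> ! i, \<pi> ! j)" by (simp add: at_within_def)
  have "((\<lambda>x. cleared_den \<sigma> \<pi> i j ?c x / cleared_den \<sigma> \<pi> i j \<alpha> x) \<longlongrightarrow> ?c i j / \<alpha> i j) ?F"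
    by (intro tendsto_divide tendsto_mono[OF le] tendsto_cleared_den assms)
  moreover have "eventually (\<lambda>x. cleared_den \<sigma> \<pi> i j ?c x / cleared_den \<sigma> \<pi> i j \<alpha> x =
      vec_nth (vec_nth (mimo_approx \<sigma> \<pi> \<alpha> H x) r) c) ?F"
    unfolding eventually_at_filter
  proof (intro always_eventually allI impI)
    fix x assume "x \<in> bary_dom \<sigma> \<pi> \<alpha>"
    moreover obtain s p where x: "x = (s, p)" by fastforce
    ultimately have "s \<notin> set \<sigma>" "p \<notin> set \<pi>" by (auto simp: bary_dom_def)
    then have "s \<noteq> \<sigma> ! i" "p \<noteq> \<pi> ! j" using assms by auto
    then show "cleared_den \<sigma> \<pi> i j ?c x / cleared_den \<sigma> \<pi> i j \<alpha> x =
      vec_nth (vec_nth (mimo_approx \<sigma> \<pi> \<alpha> H x) r) c"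
      by (simp add: x cleared_den_eq mimo_approx_nth)
  qed
  ultimately show "((\<lambda>x. vec_nth (vec_nth (mimo_approx \<sigma> \<pi> \<alpha> H x) r) c) \<longlongrightarrow>
      vec_nth (vec_nth (H (\<sigma> ! i) (\<pi> ! j)) r) c) ?F"
    using assms(5) by (auto dest: Lim_transform_eventually)
qed

section \<open>The least-squares measure\<close>

lemma weighted_diff: "weighted w (A - B) v = weighted w A v - weighted w B v"
  by (simp add: weighted_def scalar_product_def matrix_vector_mult_diff_rdistrib
      right_diff_distrib sum_subtractf)

lemma weighted_cscale: "weighted w (cscale c A) v = c * weighted w A v"
  by (simp add: weighted_def scalar_product_def cscale_def map_matrix_def matrix_vector_mult_def
      sum_distrib_left mult_ac)

lemma weighted_sum: "weighted w (\<Sum>i\<in>I. A i) v = (\<Sum>i\<in>I. weighted w (A i) v)"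
proof (induction I rule: infinite_finite_induct)
  case (insert i I)
  then show ?case
    \<comment> \<open>Additivity is obtained from differences: subtracting \<open>A i\<close> from
      the enlarged sum leaves the old sum.\<close>
    using weighted_diff[of w "A i + (\<Sum>i\<in>I. A i)" "A i" v] by simp
qed (use weighted_diff[of w 0 0 v] in simp_all)

lemmas weighted_linear = weighted_diff weighted_cscale weighted_sum

section \<open>Stacked coefficients and squared norms as sums\<close>

lemma sum_stack: "(\<Sum>c<k * q. f (c div q) (c mod q)) = (\<Sum>i<k. \<Sum>j<q. f i j)"
  for f :: "nat \<Rightarrow> nat \<Rightarrow> 'a::comm_monoid_add"
proof (cases "q = 0")
  case False
  \<comment> \<open>The range is cut into \<open>k\<close> blocks of length \<open>q\<close>; block
    \<open>i\<close> consists of the \<open>c = i * q + j\<close> with \<open>j < q\<close>.\<close>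
  have "(\<Sum>c<k * q. f (c div q) (c mod q)) =
      (\<Sum>i<k. \<Sum>c\<in>{i * q..<i * q + q}. f (c div q) (c mod q))"
    by (simp add: sum.nat_group)
  also have "\<dots> = (\<Sum>i<k. \<Sum>j<q. f i j)"
  proof (rule sum.cong[OF refl])
    fix i
    have "(\<Sum>c\<in>{i * q..<i * q + q}. f (c div q) (c mod q)) =
        (\<Sum>j\<in>{0..<q}. f ((j + i * q) div q) ((j + i * q) mod q))"
      using sum.shift_bounds_nat_ivl[of "\<lambda>c. f (c div q) (c mod q)" 0 "i * q" q] by (simp add: add.commute)
    also have "\<dots> = (\<Sum>j<q. f i j)"
      by (intro sum.cong) auto
    finally show "(\<Sum>c\<in>{i * q..<i * q + q}. f (c div q) (c mod q)) = (\<Sum>j<q. f i j)" .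
  qed
  finally show ?thesis .
qed simp

text \<open>All rows of \<open>loewner2\<close> depend on \<open>c\<close> only through
  \<open>c div q\<close> and \<open>c mod q\<close>, so this evaluates each of them against the
  coefficients.\<close>

lemma vec_stack_scalar_prod:
  "Matrix.vec (k * q) (\<lambda>c. f (c div q) (c mod q)) \<bullet> stack k q \<beta> = (\<Sum>i<k. \<Sum>j<q. f i j * \<beta> i j)"
proof -
  have "Matrix.vec (k * q) (\<lambda>c. f (c div q) (c mod q)) \<bullet> stack k q \<beta> =
      (\<Sum>c<k * q. f (c div q) (c mod q) * \<beta> (c div q) (c mod q))"
    by (auto simp: scalar_prod_def stack_def lessThan_atLeast0 intro!: sum.cong)
  then show ?thesis using sum_stack[of "\<lambda>i j. f i j * \<beta> i j"] by simp
qed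

lemma vec_norm2_power2: "(vec_norm2 a)\<^sup>2 = (\<Sum>c<dim_vec a. (cmod (vec_index a c))\<^sup>2)"
  by (simp add: vec_norm2_def L2_set_def sum_nonneg)

lemma vec_norm2_nonneg: "vec_norm2 a \<ge> 0"
  by (simp add: vec_norm2_def)

lemma vec_norm2_stack: "(vec_norm2 (stack k q \<beta>))\<^sup>2 = (\<Sum>i<k. \<Sum>j<q. (cmod (\<beta> i j))\<^sup>2)"
  using sum_stack[of "\<lambda>i j. (cmod (\<beta> i j))\<^sup>2"]
  by (simp add: vec_norm2_power2 stack_def)

text \<open>Summing over the list of rows avoids computing the position of a row in the concatenated
  blocks.\<close>

lemma vec_norm2_mat_of_rows:
  assumes "set rs \<subseteq> carrier_vec n"
  shows "(vec_norm2 (mat_of_rows n rs *\<^sub>v a))\<^sup>2 = (\<Sum>r\<leftarrow>rs. (cmod (r \<bullet> a))\<^sup>2)"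
proof -
  have "(\<Sum>r\<leftarrow>rs. (cmod (r \<bullet> a))\<^sup>2) = (\<Sum>i<length rs. (cmod ((rs ! i) \<bullet> a))\<^sup>2)"
    by (simp add: sum_list_sum_nth lessThan_atLeast0)
  also have "\<dots> = (\<Sum>i<length rs. (cmod (Matrix.row (mat_of_rows n rs) i \<bullet> a))\<^sup>2)"
    using assms by (intro sum.cong) (auto simp: subset_iff)
  finally show ?thesis by (simp add: vec_norm2_power2)
qed

text \<open>The comprehensions in \<open>loewner2\<close> unfold to this shape; distinctness turns
  their list sums into the set sums of \<open>weighted_ls\<close>.\<close>

lemma sum_list_comprehension:
  fixes g :: "'c \<Rightarrow> real"
  assumes "distinct xs" "distinct ys"
  shows "sum_list (map g (concat (map (\<lambda>x. map (F x) ys) xs))) = (\<Sum>x\<in>set xs. \<Sum>y\<in>set ys. g (F x y))"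
proof -
  have "sum_list (map g (concat (map (\<lambda>x. map (F x) ys) xs))) = (\<Sum>x\<leftarrow>xs. \<Sum>y\<leftarrow>ys. g (F x y))"
    by (induction xs) (simp_all add: o_def)
  then show ?thesis using assms by (simp add: sum_list_distinct_conv_sum_set)
qed

text \<open>By linearity, \<open>H d\<close> and \<open>N\<close> share the coefficient of each
  \<open>\<beta> i j\<close>, and their difference is a row entry of the Loewner matrix for the
  weighted data. The next two lemmas do the same for the other kinds of pairs.\<close>

lemma weighted_residual_row:
  "weighted w (residual_row \<sigma> \<pi> H \<beta> i p) v =
     (\<Sum>j<length \<pi>. (weighted w (H (\<sigma> ! i) p) v - weighted w (H (\<sigma> ! i) (\<pi> ! j)) v) / (p - \<pi> ! j) * \<beta> i j)"
  by (simp add: residual_row_def weighted_linear sum_distrib_right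
      flip: sum_subtractf) (simp add: diff_divide_distrib algebra_simps)

lemma weighted_residual_col:
  "weighted w (residual_col \<sigma> \<pi> H \<beta> s j) v =
     (\<Sum>i<length \<sigma>. (weighted w (H s (\<pi> ! j)) v - weighted w (H (\<sigma> ! i) (\<pi> ! j)) v) / (s - \<sigma> ! i) * \<beta> i j)"
  by (simp add: residual_col_def weighted_linear sum_distrib_right
      flip: sum_subtractf) (simp add: diff_divide_distrib algebra_simps)

lemma weighted_residual_off:
  "weighted w (residual_off \<sigma> \<pi> H \<beta> s p) v =
     (\<Sum>i<length \<sigma>. \<Sum>j<length \<pi>. (weighted w (H s p) v - weighted w (H (\<sigma> ! i) (\<pi> ! j)) v)
        / ((s - \<sigma> ! i) * (p - \<pi> ! j)) * \<beta> i j)"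
  by (simp add: residual_off_def bary_den_def bary_num_mat_def weighted_linear sum_distrib_right
      flip: sum_subtractf) (simp add: diff_divide_distrib algebra_simps)

lemma weighted_ls_eq_loewner2:
  assumes "distinct ss" "distinct ps"
  shows "weighted_ls w v ss ps H \<sigma> \<pi> \<beta> =
    (vec_norm2 (loewner2 ss ps (\<lambda>s p. weighted w (H s p) v) \<sigma> \<pi> *\<^sub>v stack (length \<sigma>) (length \<pi>) \<beta>))\<^sup>2"
proof -
  let ?k = "length \<sigma>" and ?q = "length \<pi>" and ?h = "\<lambda>s p. weighted w (H s p) v"
  have rem: "distinct (remaining xs zs)" "set (remaining xs zs) = set xs - set zs"
    if "distinct xs" for xs zs
    using that by (auto simp: remaining_def)
  have row: "Matrix.vec (?k * ?q) (\<lambda>c. if c div ?q = i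
          then (?h (\<sigma> ! i) y - ?h (\<sigma> ! i) (\<pi> ! (c mod ?q))) / (y - \<pi> ! (c mod ?q)) else 0)
      \<bullet> stack ?k ?q \<beta> = weighted w (residual_row \<sigma> \<pi> H \<beta> i y) v" if "i < ?k" for i y
  proof -
    \<comment> \<open>The selector depends on the outer index only; pulled out of the inner sum, it
      collapses the outer sum to \<open>a = i\<close>.\<close>
    have "(\<Sum>a<?k. \<Sum>j<?q. (if a = i then (?h (\<sigma> ! i) y - ?h (\<sigma> ! i) (\<pi> ! j)) / (y - \<pi> ! j) else 0) * \<beta> a j)
        = (\<Sum>a<?k. if a = i then (\<Sum>j<?q. (?h (\<sigma> ! i) y - ?h (\<sigma> ! i) (\<pi> ! j)) / (y - \<pi> ! j) * \<beta> a j) else 0)"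
      by (intro sum.cong) auto
    then show ?thesis using that
      by (subst vec_stack_scalar_prod) (simp add: weighted_residual_row)
  qed
  have col: "Matrix.vec (?k * ?q) (\<lambda>c. if c mod ?q = j
          then (?h x (\<pi> ! j) - ?h (\<sigma> ! (c div ?q)) (\<pi> ! j)) / (x - \<sigma> ! (c div ?q)) else 0)
      \<bullet> stack ?k ?q \<beta> = weighted w (residual_col \<sigma> \<pi> H \<beta> x j) v" if "j < ?q" for j x
  proof -
    have "(\<Sum>i<?k. \<Sum>b<?q. (if b = j then (?h x (\<pi> ! j) - ?h (\<sigma> ! i) (\<pi> ! j)) / (x - \<sigma> ! i) else 0) * \<beta> i b)
        = (\<Sum>i<?k. \<Sum>b<?q. if b = j then (?h x (\<pi> ! j) - ?h (\<sigma> ! i) (\<pi> ! j)) / (x - \<sigma> ! i) * \<beta> i b else 0)"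
      by (intro sum.cong) auto
    then show ?thesis using that
      by (subst vec_stack_scalar_prod) (simp add: weighted_residual_col)
  qed
  have off: "Matrix.vec (?k * ?q) (\<lambda>c. (?h x y - ?h (\<sigma> ! (c div ?q)) (\<pi> ! (c mod ?q)))
          / ((x - \<sigma> ! (c div ?q)) * (y - \<pi> ! (c mod ?q))))
      \<bullet> stack ?k ?q \<beta> = weighted w (residual_off \<sigma> \<pi> H \<beta> x y) v" for x y
    by (subst vec_stack_scalar_prod) (simp add: weighted_residual_off)
  have "(vec_norm2 (loewner2 ss ps ?h \<sigma> \<pi> *\<^sub>v stack ?k ?q \<beta>))\<^sup>2 =
      (\<Sum>i<?k. \<Sum>p\<in>set ps - set \<pi>. (cmod (weighted w (residual_row \<sigma> \<pi> H \<beta> i p) v))\<^sup>2) +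
      ((\<Sum>j<?q. \<Sum>s\<in>set ss - set \<sigma>. (cmod (weighted w (residual_col \<sigma> \<pi> H \<beta> s j) v))\<^sup>2) +
       (\<Sum>s\<in>set ss - set \<sigma>. \<Sum>p\<in>set ps - set \<pi>. (cmod (weighted w (residual_off \<sigma> \<pi> H \<beta> s p) v))\<^sup>2))"
    unfolding loewner2_def Let_def
    apply (subst vec_norm2_mat_of_rows)
     apply auto[1]
    apply (simp only: map_append sum_list_append sum_list_comprehension rem assms distinct_upt set_upt)
    apply (intro arg_cong2[where f = "(+)"] sum.cong arg_cong[where f = "\<lambda>x. (cmod x)\<^sup>2"] row col off)
         apply auto
    done
  \<comment> \<open>The blocks are reordered, and the column block, listed with \<open>j\<close>
    outermost, has its two sums swapped.\<close>
  then show ?thesis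
    by (simp add: weighted_ls_def sum.swap[of _ "set ss - set \<sigma>" "{..<?q}"])
qed

section \<open>Interpolation and optimality of the result\<close>

text \<open>A step appends a point only if it is not yet in the list.\<close>

lemma paaa_reach_distinct:
  assumes "paaa_reach stop ss ps h (\<sigma>, \<pi>, \<alpha>)"
  shows "distinct \<sigma> \<and> distinct \<pi>"
  using assms
proof (induction "(\<sigma>, \<pi>, \<alpha>)" arbitrary: \<sigma> \<pi> \<alpha> rule: paaa_reach.induct)
  case (iterate st)
  then show ?case by (cases st) (auto elim!: paaa_step.cases)
qed simp

text \<open>\<open>\<sigma> \<noteq> []\<close> excludes the start state, so the state comes from a
  step, which ends with this minimization for the updated lists.\<close>

lemma paaa_reach_arg_min:
  assumes "paaa_reach stop ss ps h (\<sigma>, \<pi>, \<alpha>)" "\<sigma> \<noteq> []"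
  shows "is_arg_min (\<lambda>a. vec_norm2 (loewner2 ss ps h \<sigma> \<pi> *\<^sub>v a))
     (\<lambda>a. a \<in> carrier_vec (length \<sigma> * length \<pi>) \<and> vec_norm2 a = 1) (stack (length \<sigma>) (length \<pi>) \<alpha>)"
  using assms by (auto elim!: paaa_reach.cases paaa_step.cases)

text \<open>Every admissible \<open>\<beta>\<close> stacks to a unit vector competing with that of
  \<open>\<alpha>\<close>; squaring preserves the order of the nonnegative norms.\<close>

lemma is_arg_min_weighted_ls:
  assumes "distinct ss" "distinct ps"
    and "is_arg_min (\<lambda>a. vec_norm2 (loewner2 ss ps (\<lambda>s p. weighted w (H s p) v) \<sigma> \<pi> *\<^sub>v a))
     (\<lambda>a. a \<in> carrier_vec (length \<sigma> * length \<pi>) \<and> vec_norm2 a = 1) (stack (length \<sigma>) (length \<pi>) \<alpha>)"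
  shows "is_arg_min (weighted_ls w v ss ps H \<sigma> \<pi>)
    (\<lambda>\<beta>. (\<Sum>i<length \<sigma>. \<Sum>j<length \<pi>. (cmod (\<beta> i j))\<^sup>2) = 1) \<alpha>"
proof -
  have unit: "(\<Sum>i<length \<sigma>. \<Sum>j<length \<pi>. (cmod (\<beta> i j))\<^sup>2) = 1 \<longleftrightarrow>
      vec_norm2 (stack (length \<sigma>) (length \<pi>) \<beta>) = 1" for \<beta>
    using vec_norm2_nonneg[of "stack (length \<sigma>) (length \<pi>) \<beta>"]
    by (auto simp: power2_eq_1_iff simp flip: vec_norm2_stack)
  have "stack (length \<sigma>) (length \<pi>) \<beta> \<in> carrier_vec (length \<sigma> * length \<pi>)" for \<beta>
    by (simp add: stack_def)
  then show ?thesis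
    using assms(3) unfolding is_arg_min_linorder unit weighted_ls_eq_loewner2[OF assms(1,2)]
    by (auto intro!: power_mono vec_norm2_nonneg)
qed

theorem proposition4p1:
  fixes H :: "complex \<Rightarrow> complex \<Rightarrow> complex^'n_in^'n_out"
    and w :: "complex^'n_out" and v :: "complex^'n_in"
    and ss ps \<sigma> \<pi> :: "complex list"
    and \<alpha> :: "nat \<Rightarrow> nat \<Rightarrow> complex"
    and stop :: "paaa_state \<Rightarrow> bool"
  assumes "distinct ss" and "distinct ps"
    and "norm w = 1" and "norm v = 1"
    and "mimo_paaa_result stop w v ss ps H (\<sigma>, \<pi>, \<alpha>)"
    and "\<sigma> \<noteq> []" and "\<pi> \<noteq> []"
    and "\<forall>i<length \<sigma>. \<forall>j<length \<pi>. \<alpha> i j \<noteq> 0"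
  shows "(\<forall>i<length \<sigma>. \<forall>j<length \<pi>.
            takes_value (mimo_approx \<sigma> \<pi> \<alpha> H) (bary_dom \<sigma> \<pi> \<alpha>) (\<sigma> ! i, \<pi> ! j) (H (\<sigma> ! i) (\<pi> ! j)))
       \<and> is_arg_min (weighted_ls w v ss ps H \<sigma> \<pi>)
            (\<lambda>\<beta>. (\<Sum>i<length \<sigma>. \<Sum>j<length \<pi>. (cmod (\<beta> i j))\<^sup>2) = 1) \<alpha>"
proof -
  have reach: "paaa_reach stop ss ps (\<lambda>s p. weighted w (H s p) v) (\<sigma>, \<pi>, \<alpha>)"
    using assms(5) by (simp add: mimo_paaa_result_def paaa_result_def)
  show ?thesis
    \<comment> \<open>The run enters through distinctness of the selected points, for the limit, and
      minimality of its last coefficients, for the measure.\<close>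
    using paaa_reach_distinct[OF reach] assms
    by (simp add: mimo_approx_interpolates is_arg_min_weighted_ls paaa_reach_arg_min[OF reach])
qed

end
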